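(* Let $\mathfrak{P}_{\mathrm{sg}}=\mathfrak{P}_{\mathrm{sg}}(M,\sigma,\bar K)$ with $M,\sigma>0$, $\bar K\ge2$ fixed. Over $\mathfrak{P}_{\mathrm{sg}}$, no minimax regret-optimal bandit algorithm, i.e. no algorithm satisfying $\mathcal R_T\le c_0\sqrt T$ (for all $T$) for some $c_0>0$, exhibits sampling stability.
   Context: Stochastic multi-armed bandit. There are $K$ arms; for each arm $i\in[K]=\{1,\dots,K\}$, $(X^i_s)_{s\ge1}$ is an i.i.d. reward sequence with law $\nu_i$, independent across arms; $\nu=(\nu_1,\dots,\nu_K)$ is the (unknown) bandit instance. For a horizon $T$, an algorithm selects at each time $t\in[T]$ an arm $A_t\sim\pi_t(\cdot\mid\mathcal H_{t-1})$, where $\mathcal H_{t-1}=(A_1,r_1,\dots,A_{t-1},r_{t-1})$ is the observed history, $\pi_t(\cdot\mid \mathcal H_{t-1})$ is a distribution on $[K]$, $N_{i,t}=\sum_{s=1}^t\mathbf 1\{A_s=i\}$, and $r_t=X^{A_t}_{N_{A_t,t}}$. An algorithm thus specifies decision rules $(\pi_t)_{t\in[T]}$ for every horizon $T$ and every number of arms $K$ (the rules may depend on $T$, $K$). We write $N_{i,T}(\nu)$ for $N_{i,T}$ under instance $\nu$. Let $\mu_i$ be the mean of $\nu_i$, $\Delta_i=\max_j\mu_j-\mu_i$. Regret: $R_T(\nu)=\sum_{i=1}^K\Delta_i\,\mathbb E[N_{i,T}]$. $\mathfrak{P}_{\mathrm{sg}}(M,\sigma,\bar K)$ is the class of instances $\nu=(\nu_1,\dots,\nu_K)$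 with $2\le K\le\bar K$ such that each $\nu_i$ has mean $\mu_i\in[-M,M]$ and is $\sigma$-sub-Gaussian. $\mathcal R_T=\sup_{\nu\in\mathfrak{P}_{\mathrm{sg}}}R_T(\nu)$. Standing assumptions on algorithms: (i) if $\nu_i=\nu_j$ for some $i\ne j$ then $\mathbb E[N_{i,T}]=\mathbb E[N_{j,T}]$; (ii) for $T\ge K$, $\mathbb E[N_{i,T}]\ge1$ for each arm $i$. Sampling stability over an instance class $\mathfrak P$: for any instance $\nu\in\mathfrak P$ and any arm $i\in[K]$ there exist non-random scalars $n_{i,T}(\nu)$ such that $N_{i,T}(\nu)/n_{i,T}(\nu)\to1$ in probability and $n_{i,T}(\nu)\to\infty$ as $T\to\infty$. *)

theory Defs
  imports "HOL-Probability.Probability"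
begin

text \<open>
  An instance with K arms is a family \<open>\<nu>\<close> of reward laws, of which only
  \<open>\<nu> 1, \<dots>, \<nu> K\<close> matter.
  A history lists the (arm, reward) pairs observed so far, oldest first. An algorithm maps the
  horizon T, the number of arms K and a history of length t - 1 to the law of the t-th arm.
\<close>

type_synonym history = "(nat \<times> real) list"
type_synonym algorithm = "nat \<Rightarrow> nat \<Rightarrow> history \<Rightarrow> nat pmf"

text \<open>
  The measurability clause says that every decision rule is a probability kernel from the space of
  histories of length t to the set of arms; lists are coded as functions on \<open>{..<t}\<close>.
\<close>

definition bandit_algorithm :: "algorithm \<Rightarrow> bool" where
  "bandit_algorithm \<pi> \<longleftrightarrow>
    (\<forall>T. \<forall>K\<ge>1. \<forall>t<T.
      (\<forall>h. length h = t \<and> fst ` set h \<subseteq> {1..K} \<longrightarrow> set_pmf (\<pi> T K h) \<subseteq> {1..K}) \<and>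
      (\<lambda>h. measure_pmf (\<pi> T K (map h [0..<t])))
        \<in> (\<Pi>\<^sub>M s\<in>{..<t}. count_space {1..K} \<Otimes>\<^sub>M borel) \<rightarrow>\<^sub>M subprob_algebra (count_space UNIV))"

definition pulls :: "nat \<Rightarrow> nat list \<Rightarrow> nat" where
  "pulls i as = count_list as i"

text \<open>
  The reward table holds the s-th reward of arm i at position (i, s).
\<close>

definition reward_table :: "nat \<Rightarrow> (nat \<Rightarrow> real measure) \<Rightarrow> (nat \<times> nat \<Rightarrow> real) measure" where
  "reward_table K \<nu> = (\<Pi>\<^sub>M (i, s)\<in>{1..K} \<times> {1..}. \<nu> i)"

text \<open>
  Law of the history after a given number of rounds, conditionally on the reward table X.
  The reward of the chosen arm a is its N-th one, where N counts the pulls of a including the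
  current one.
\<close>

primrec history_pmf :: "(history \<Rightarrow> nat pmf) \<Rightarrow> (nat \<times> nat \<Rightarrow> real) \<Rightarrow> nat \<Rightarrow> history pmf" where
  "history_pmf p X 0 = return_pmf []"
| "history_pmf p X (Suc t) =
    bind_pmf (history_pmf p X t) (\<lambda>h.
    map_pmf (\<lambda>a. h @ [(a, X (a, Suc (pulls a (map fst h))))]) (p h))"

text \<open>
  Law of the sequence of arms chosen up to the horizon T. It determines the law of all the
  pull counts, which are obtained by applying \<open>pulls\<close>.
\<close>

definition arms_law :: "algorithm \<Rightarrow> nat \<Rightarrow> nat \<Rightarrow> (nat \<Rightarrow> real measure) \<Rightarrow> nat list measure" where
  "arms_law \<pi> T K \<nu> =
    reward_table K \<nu> \<bind> (\<lambda>X. measure_pmf (map_pmf (map fst) (history_pmf (\<pi> T K) X T)))"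

definition expected_pulls ::
  "algorithm \<Rightarrow> nat \<Rightarrow> nat \<Rightarrow> (nat \<Rightarrow> real measure) \<Rightarrow> nat \<Rightarrow> real" where
  "expected_pulls \<pi> T K \<nu> i = (\<integral>as. real (pulls i as) \<partial>arms_law \<pi> T K \<nu>)"

definition mean :: "real measure \<Rightarrow> real" where
  "mean \<rho> = (\<integral>x. x \<partial>\<rho>)"

definition gap :: "nat \<Rightarrow> (nat \<Rightarrow> real measure) \<Rightarrow> nat \<Rightarrow> real" where
  "gap K \<nu> i = (MAX j\<in>{1..K}. mean (\<nu> j)) - mean (\<nu> i)"

definition regret :: "algorithm \<Rightarrow> nat \<Rightarrow> nat \<Rightarrow> (nat \<Rightarrow> real measure) \<Rightarrow> real" where
  "regret \<pi> T K \<nu> = (\<Sum>i\<in>{1..K}. gap K \<nu> i * expected_pulls \<pi> T K \<nu> i)"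

definition sub_gaussian :: "real \<Rightarrow> real measure \<Rightarrow> bool" where
  "sub_gaussian \<sigma> \<rho> \<longleftrightarrow>
    (\<forall>l. integrable \<rho> (\<lambda>x. exp (l * (x - mean \<rho>))) \<and>
         (\<integral>x. exp (l * (x - mean \<rho>)) \<partial>\<rho>) \<le> exp (l\<^sup>2 * \<sigma>\<^sup>2 / 2))"

definition sg_class :: "real \<Rightarrow> real \<Rightarrow> nat \<Rightarrow> (nat \<times> (nat \<Rightarrow> real measure)) set" where
  "sg_class M \<sigma> Kbar = {(K, \<nu>). 2 \<le> K \<and> K \<le> Kbar \<and>
    (\<forall>i\<in>{1..K}. prob_space (\<nu> i) \<and> sets (\<nu> i) = sets borel \<and>
      integrable (\<nu> i) (\<lambda>x. x) \<and> mean (\<nu> i) \<in> {-M..M} \<and> sub_gaussian \<sigma> (\<nu> i))}"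

text \<open>
  The supremum is taken in the extended reals, so that it is meaningful without a boundedness
  proof.
\<close>

definition minimax_regret ::
  "(nat \<times> (nat \<Rightarrow> real measure)) set \<Rightarrow> algorithm \<Rightarrow> nat \<Rightarrow> ereal" where
  "minimax_regret P \<pi> T = (SUP (K, \<nu>)\<in>P. ereal (regret \<pi> T K \<nu>))"

definition minimax_optimal :: "(nat \<times> (nat \<Rightarrow> real measure)) set \<Rightarrow> algorithm \<Rightarrow> bool" where
  "minimax_optimal P \<pi> \<longleftrightarrow> (\<exists>c\<^sub>0>0. \<forall>T. minimax_regret P \<pi> T \<le> ereal (c\<^sub>0 * sqrt (real T)))"

definition symmetric_on :: "(nat \<times> (nat \<Rightarrow> real measure)) set \<Rightarrow> algorithm \<Rightarrow> bool" where
  "symmetric_on P \<pi> \<longleftrightarrow>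
    (\<forall>(K, \<nu>)\<in>P. \<forall>T. \<forall>i\<in>{1..K}. \<forall>j\<in>{1..K}. i \<noteq> j \<and> \<nu> i = \<nu> j \<longrightarrow>
      expected_pulls \<pi> T K \<nu> i = expected_pulls \<pi> T K \<nu> j)"

definition explores_on :: "(nat \<times> (nat \<Rightarrow> real measure)) set \<Rightarrow> algorithm \<Rightarrow> bool" where
  "explores_on P \<pi> \<longleftrightarrow>
    (\<forall>(K, \<nu>)\<in>P. \<forall>T\<ge>K. \<forall>i\<in>{1..K}. expected_pulls \<pi> T K \<nu> i \<ge> 1)"

text \<open>
  Convergence to 1 in probability is spelled out because the underlying probability space
  depends on T.
\<close>

definition sampling_stable :: "(nat \<times> (nat \<Rightarrow> real measure)) set \<Rightarrow> algorithm \<Rightarrow> bool" where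
  "sampling_stable P \<pi> \<longleftrightarrow>
    (\<forall>(K, \<nu>)\<in>P. \<forall>i\<in>{1..K}. \<exists>n :: nat \<Rightarrow> real.
      filterlim n at_top sequentially \<and>
      (\<forall>\<epsilon>>0. (\<lambda>T. measure (arms_law \<pi> T K \<nu>) {as. \<bar>real (pulls i as) / n T - 1\<bar> > \<epsilon>})
        \<longlonglongrightarrow> 0))"

end

theory Submission
  imports Defs
begin

text \<open>
  Take two arms with reward law \<open>N(0, \<sigma>\<^sup>2)\<close>. By symmetry each arm is pulled T/2 times on average, so
  stability forces \<open>N\<^sub>1 \<ge> T/6\<close> with probability tending to 1. Now raise the mean of the second arm
  to \<open>C / sqrt T\<close>. A horizon T only reveals the first T rewards of each arm, so the two laws of the
  arm sequence can be compared through the likelihood ratio L of the first T rewards of the second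
  arm, whatever the algorithm does. The second moment of L is \<open>exp (C\<^sup>2 / \<sigma>\<^sup>2)\<close>, independently of T,
  so \<open>N\<^sub>1 < T/6\<close> is still asymptotically negligible under the new instance. The regret is then at
  least about \<open>C sqrt T / 6\<close>, which exceeds \<open>c\<^sub>0 sqrt T\<close> once C is large.
\<close>

section \<open>Gaussian laws\<close>

definition gaussian :: "real \<Rightarrow> real \<Rightarrow> real measure" where
  "gaussian \<sigma> m = density lborel (\<lambda>x. ennreal (normal_density m \<sigma> x))"

lemma sets_gaussian [simp, measurable_cong]: "sets (gaussian \<sigma> m) = sets borel"
  and space_gaussian [simp]: "space (gaussian \<sigma> m) = UNIV"
  by (simp_all add: gaussian_def)

lemma prob_space_gaussian: "\<sigma> > 0 \<Longrightarrow> prob_space (gaussian \<sigma> m)"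
  unfolding gaussian_def by (rule prob_space_normal_density)

lemma integrable_gaussian_ident: "\<sigma> > 0 \<Longrightarrow> integrable (gaussian \<sigma> m) (\<lambda>x. x)"
  unfolding gaussian_def
  by (subst integrable_density) (auto intro: integrable_normal_moment_nz_1)

lemma mean_gaussian: "\<sigma> > 0 \<Longrightarrow> mean (gaussian \<sigma> m) = m"
  unfolding gaussian_def mean_def
  by (subst integral_density) (auto intro: integral_normal_moment_nz_1)

text \<open>Completing the square in the exponent. This one identity yields the moment generating
  function, the sub-Gaussian bound (with equality) and the likelihood ratio of a mean shift.\<close>

lemma normal_density_tilt:
  assumes "\<sigma> > 0"
  shows "normal_density m \<sigma> x * exp (l * (x - m)) =
    exp (l\<^sup>2 * \<sigma>\<^sup>2 / 2) * normal_density (m + l * \<sigma>\<^sup>2) \<sigma> x"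
proof -
  have "- (x - m)\<^sup>2 / (2 * \<sigma>\<^sup>2) + l * (x - m) =
      l\<^sup>2 * \<sigma>\<^sup>2 / 2 + - (x - (m + l * \<sigma>\<^sup>2))\<^sup>2 / (2 * \<sigma>\<^sup>2)"
    using assms by (simp add: field_simps power2_eq_square)
  then have "exp (- (x - m)\<^sup>2 / (2 * \<sigma>\<^sup>2)) * exp (l * (x - m)) =
      exp (l\<^sup>2 * \<sigma>\<^sup>2 / 2) * exp (- (x - (m + l * \<sigma>\<^sup>2))\<^sup>2 / (2 * \<sigma>\<^sup>2))"
    unfolding exp_add[symmetric] by (rule arg_cong)
  then show ?thesis
    by (simp add: normal_density_def)
qed

text \<open>After tilting, the integrand is a constant times another normal density, whose total
  mass is 1.\<close>

lemma gaussian_mgf: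
  assumes "\<sigma> > 0"
  shows "integrable (gaussian \<sigma> m) (\<lambda>x. exp (l * (x - m)))"
    and "(\<integral>x. exp (l * (x - m)) \<partial>gaussian \<sigma> m) = exp (l\<^sup>2 * \<sigma>\<^sup>2 / 2)"
  using assms unfolding gaussian_def
  by (simp_all add: integrable_density integral_density normal_density_tilt)

lemma sub_gaussian_gaussian: "\<sigma> > 0 \<Longrightarrow> sub_gaussian \<sigma> (gaussian \<sigma> m)"
  by (simp add: sub_gaussian_def mean_gaussian gaussian_mgf)

text \<open>The likelihood ratio of the normal law with mean \<open>d\<close> against the centred
  one with the same variance, in closed form.\<close>

definition gaussian_ratio :: "real \<Rightarrow> real \<Rightarrow> real \<Rightarrow> real" where
  "gaussian_ratio \<sigma> d x = exp (d / \<sigma>\<^sup>2 * x - d\<^sup>2 / (2 * \<sigma>\<^sup>2))"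

lemma gaussian_ratio_nonneg [simp]: "gaussian_ratio \<sigma> d x \<ge> 0"
  by (simp add: gaussian_ratio_def)

lemma borel_measurable_gaussian_ratio [measurable]: "gaussian_ratio \<sigma> d \<in> borel_measurable borel"
  unfolding gaussian_ratio_def by measurable

lemma density_gaussian_ratio:
  assumes "\<sigma> > 0"
  shows "density (gaussian \<sigma> 0) (\<lambda>x. ennreal (gaussian_ratio \<sigma> d x)) = gaussian \<sigma> d"
proof -
  let ?l = "d / \<sigma>\<^sup>2"
  have "gaussian_ratio \<sigma> d x = exp (?l * (x - 0)) / exp (?l\<^sup>2 * \<sigma>\<^sup>2 / 2)" for x
    using assms by (simp add: gaussian_ratio_def field_simps power2_eq_square flip: exp_diff)
  then have "normal_density 0 \<sigma> x * gaussian_ratio \<sigma> d x = normal_density d \<sigma> x" for x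
    using normal_density_tilt[OF assms, of 0 x ?l] assms by simp
  then show ?thesis
    unfolding gaussian_def
    by (subst density_density_eq) (auto simp: ennreal_mult[symmetric])
qed

text \<open>Squaring the ratio doubles the linear term of the exponent, so the second moment is
  again a value of the moment generating function. The shift enters only through
  \<open>d\<^sup>2\<close>: a product of T such factors stays bounded when \<open>d\<close> is of
  order \<open>1 / sqrt T\<close>.\<close>

lemma nn_integral_gaussian_ratio_sq:
  assumes "\<sigma> > 0"
  shows "(\<integral>\<^sup>+x. ennreal ((gaussian_ratio \<sigma> d x)\<^sup>2) \<partial>gaussian \<sigma> 0) = ennreal (exp (d\<^sup>2 / \<sigma>\<^sup>2))"
proof -
  have eq: "(gaussian_ratio \<sigma> d x)\<^sup>2 = exp (- (d\<^sup>2 / \<sigma>\<^sup>2)) * exp (2 * d / \<sigma>\<^sup>2 * (x - 0))" for x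
    by (simp add: gaussian_ratio_def power2_eq_square field_simps flip: exp_add)
  have "(\<integral>\<^sup>+x. ennreal ((gaussian_ratio \<sigma> d x)\<^sup>2) \<partial>gaussian \<sigma> 0) =
      ennreal (\<integral>x. exp (- (d\<^sup>2 / \<sigma>\<^sup>2)) * exp (2 * d / \<sigma>\<^sup>2 * (x - 0)) \<partial>gaussian \<sigma> 0)"
    unfolding eq using assms gaussian_mgf(1)[OF assms, of 0 "2 * d / \<sigma>\<^sup>2"]
    by (intro nn_integral_eq_integral) auto
  also have "\<dots> = ennreal (exp (- (d\<^sup>2 / \<sigma>\<^sup>2)) * exp ((2 * d / \<sigma>\<^sup>2)\<^sup>2 * \<sigma>\<^sup>2 / 2))"
    using gaussian_mgf(2)[OF assms, of 0 "2 * d / \<sigma>\<^sup>2"] by simp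
  also have "\<dots> = ennreal (exp (d\<^sup>2 / \<sigma>\<^sup>2))"
    using assms by (simp add: field_simps power2_eq_square flip: exp_add)
  finally show ?thesis .
qed

section \<open>Change of measure for finite products\<close>

text \<open>It suffices to compare the two measures on rectangles, where Tonelli factorizes the
  integral. The hypotheses range over every index, inside \<open>J\<close> or not, because
  \<open>product_sigma_finite\<close> asks for this.\<close>

lemma PiM_density:
  assumes "finite J" and P: "\<And>j. prob_space (M j)" and Q: "\<And>j. prob_space (density (M j) (f j))"
    and [measurable]: "\<And>j. f j \<in> borel_measurable (M j)"
  shows "PiM J (\<lambda>j. density (M j) (f j)) = density (PiM J M) (\<lambda>x. \<Prod>j\<in>J. f j (x j))"
proof -
  interpret M: product_sigma_finite M
    using P by (simp add: product_sigma_finite_def prob_space_imp_sigma_finite)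
  interpret N: product_sigma_finite "\<lambda>j. density (M j) (f j)"
    using Q by (simp add: product_sigma_finite_def prob_space_imp_sigma_finite)
  have "density (PiM J M) (\<lambda>x. \<Prod>j\<in>J. f j (x j)) = PiM J (\<lambda>j. density (M j) (f j))"
  proof (rule N.PiM_eqI[OF \<open>finite J\<close>])
    show "sets (density (PiM J M) (\<lambda>x. \<Prod>j\<in>J. f j (x j))) = sets (PiM J (\<lambda>j. density (M j) (f j)))"
      by (simp cong: sets_PiM_cong)
  next
    fix A assume "\<And>i. i \<in> J \<Longrightarrow> A i \<in> sets (density (M i) (f i))"
    then have [measurable]: "\<And>i. i \<in> J \<Longrightarrow> A i \<in> sets (M i)" by simp
    have "emeasure (density (PiM J M) (\<lambda>x. \<Prod>j\<in>J. f j (x j))) (Pi\<^sub>E J A) =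
        (\<integral>\<^sup>+x. (\<Prod>j\<in>J. f j (x j)) * indicator (Pi\<^sub>E J A) x \<partial>PiM J M)"
      using \<open>finite J\<close> by (intro emeasure_density) (auto intro!: sets_PiM_I_finite)
    also have "\<dots> = (\<integral>\<^sup>+x. (\<Prod>j\<in>J. f j (x j) * indicator (A j) (x j)) \<partial>PiM J M)"
    proof (intro nn_integral_cong)
      fix x assume "x \<in> space (PiM J M)"
      then have "x \<in> Pi\<^sub>E J A \<longleftrightarrow> (\<forall>j\<in>J. x j \<in> A j)"
        by (auto simp: space_PiM PiE_iff)
      then have "(indicator (Pi\<^sub>E J A) x :: ennreal) = (\<Prod>j\<in>J. indicator (A j) (x j))"
        using \<open>finite J\<close> by (auto simp: indicator_def prod_zero_iff)
      then show "(\<Prod>j\<in>J. f j (x j)) * indicator (Pi\<^sub>E J A) x =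
          (\<Prod>j\<in>J. f j (x j) * indicator (A j) (x j))"
        by (simp add: prod.distrib)
    qed
    also have "\<dots> = (\<Prod>j\<in>J. \<integral>\<^sup>+x. f j x * indicator (A j) x \<partial>M j)"
      using \<open>finite J\<close> by (intro M.product_nn_integral_prod) auto
    also have "\<dots> = (\<Prod>j\<in>J. emeasure (density (M j) (f j)) (A j))"
      by (intro prod.cong refl) (simp add: emeasure_density)
    finally show "emeasure (density (PiM J M) (\<lambda>x. \<Prod>j\<in>J. f j (x j))) (Pi\<^sub>E J A) =
        (\<Prod>j\<in>J. emeasure (density (M j) (f j)) (A j))" .
  qed
  then show ?thesis ..
qed

text \<open>The likelihood ratio is a product over independent coordinates, so its second moment is
  the product of the \<open>b j\<close>. A test function with small mean under \<open>M\<close>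
  therefore keeps a small mean under the tilted product; the free parameter \<eta> balances the two
  terms.\<close>

lemma integral_PiM_density_le:
  fixes f :: "'i \<Rightarrow> 'a \<Rightarrow> real" and g :: "('i \<Rightarrow> 'a) \<Rightarrow> real"
  assumes J: "finite J" and P: "\<And>j. prob_space (M j)"
    and Q: "\<And>j. prob_space (density (M j) (\<lambda>x. ennreal (f j x)))"
    and [measurable]: "\<And>j. f j \<in> borel_measurable (M j)" "g \<in> borel_measurable (PiM J M)"
    and f0: "\<And>j x. f j x \<ge> 0" and g01: "\<And>x. 0 \<le> g x" "\<And>x. g x \<le> 1"
    and b: "\<And>j. j \<in> J \<Longrightarrow> (\<integral>\<^sup>+x. ennreal ((f j x)\<^sup>2) \<partial>M j) = ennreal (b j)" "\<And>j. b j \<ge> 0"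
    and "\<eta> > 0"
  shows "(\<integral>x. g x \<partial>PiM J (\<lambda>j. density (M j) (\<lambda>x. ennreal (f j x)))) \<le>
    \<eta> / 2 * (\<Prod>j\<in>J. b j) + (\<integral>x. g x \<partial>PiM J M) / (2 * \<eta>)"
proof -
  interpret M: product_sigma_finite M
    using P by (simp add: product_sigma_finite_def prob_space_imp_sigma_finite)
  interpret PM: prob_space "PiM J M"
    using P by (intro prob_space_PiM) auto
  interpret PN: prob_space "PiM J (\<lambda>j. density (M j) (\<lambda>x. ennreal (f j x)))"
    using Q by (intro prob_space_PiM) auto
  define L where "L x = (\<Prod>j\<in>J. f j (x j))" for x
  have L0: "L x \<ge> 0" for x
    using f0 by (auto simp: L_def intro: prod_nonneg)
  have [measurable]: "L \<in> borel_measurable (PiM J M)"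
    unfolding L_def by measurable
  have dens: "PiM J (\<lambda>j. density (M j) (\<lambda>x. ennreal (f j x))) = density (PiM J M) L"
    using f0 by (subst PiM_density[OF J P Q]) (auto simp: L_def prod_ennreal)
  \<comment> \<open>AM-GM in place of Cauchy-Schwarz for the expectation of L g\<close>
  have AMGM: "L x * g x \<le> \<eta> / 2 * (L x)\<^sup>2 + g x / (2 * \<eta>)" for x
  proof -
    have "0 \<le> (\<eta> * L x - g x)\<^sup>2" by simp
    then have "2 * \<eta> * (L x * g x) \<le> \<eta>\<^sup>2 * (L x)\<^sup>2 + (g x)\<^sup>2"
      by (simp add: power2_eq_square algebra_simps)
    also have "(g x)\<^sup>2 \<le> g x"
      using g01[of x] by (simp add: power2_eq_square mult_left_le)
    finally show ?thesis
      using \<open>\<eta> > 0\<close> by (simp add: field_simps power2_eq_square)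
  qed
  have int: "integrable (PiM J M) g"
    using g01 by (intro PM.integrable_const_bound[where B = 1]) auto
  have g0: "0 \<le> (\<integral>x. g x \<partial>PiM J M)"
    using g01 by (intro integral_nonneg_AE) auto
  have b0: "0 \<le> (\<Prod>j\<in>J. b j)"
    using b by (auto intro: prod_nonneg)
  have "integrable (PiM J (\<lambda>j. density (M j) (\<lambda>x. ennreal (f j x)))) g"
    using g01 by (intro PN.integrable_const_bound[where B = 1]) (auto simp: dens)
  \<comment> \<open>The estimate runs in \<open>ennreal\<close>, where neither \<open>L\<close> nor
    its square has to be shown integrable first.\<close>
  then have "ennreal (\<integral>x. g x \<partial>PiM J (\<lambda>j. density (M j) (\<lambda>x. ennreal (f j x)))) =
      (\<integral>\<^sup>+x. ennreal (g x) \<partial>PiM J (\<lambda>j. density (M j) (\<lambda>x. ennreal (f j x))))"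
    using g01 by (intro nn_integral_eq_integral[symmetric]) auto
  also have "\<dots> = (\<integral>\<^sup>+x. ennreal (L x * g x) \<partial>PiM J M)"
    unfolding dens using L0 g01 by (subst nn_integral_density) (auto simp: ennreal_mult)
  also have "\<dots> \<le> (\<integral>\<^sup>+x. ennreal (\<eta> / 2) * ennreal ((L x)\<^sup>2) + ennreal (1 / (2 * \<eta>)) * ennreal (g x) \<partial>PiM J M)"
    using AMGM \<open>\<eta> > 0\<close> g01
    by (intro nn_integral_mono) (simp add: ennreal_mult[symmetric] ennreal_plus[symmetric] del: ennreal_plus)
  also have "\<dots> = ennreal (\<eta> / 2) * (\<integral>\<^sup>+x. ennreal ((L x)\<^sup>2) \<partial>PiM J M) +
      ennreal (1 / (2 * \<eta>)) * (\<integral>\<^sup>+x. ennreal (g x) \<partial>PiM J M)"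
    by (simp add: nn_integral_add nn_integral_cmult)
  also have "(\<integral>\<^sup>+x. ennreal ((L x)\<^sup>2) \<partial>PiM J M) = (\<integral>\<^sup>+x. (\<Prod>j\<in>J. ennreal ((f j (x j))\<^sup>2)) \<partial>PiM J M)"
    by (simp add: L_def prod_ennreal prod_power_distrib)
  also have "\<dots> = (\<Prod>j\<in>J. ennreal (b j))"
    using J by (subst M.product_nn_integral_prod) (auto simp: b)
  also have "\<dots> = ennreal (\<Prod>j\<in>J. b j)"
    using b by (simp add: prod_ennreal)
  also have "(\<integral>\<^sup>+x. ennreal (g x) \<partial>PiM J M) = ennreal (\<integral>x. g x \<partial>PiM J M)"
    using int g01 by (intro nn_integral_eq_integral) auto
  finally show ?thesis
    using \<open>\<eta> > 0\<close> g0 b0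
    by (simp add: ennreal_mult[symmetric] ennreal_plus[symmetric] del: ennreal_plus)
qed

section \<open>The law of the arms given the reward table\<close>

text \<open>Once the table is fixed, the history is a function of the arms. Random histories can
  thus be replaced by arm lists, which form a countable type.\<close>

definition observed :: "(nat \<times> nat \<Rightarrow> real) \<Rightarrow> nat list \<Rightarrow> history" where
  "observed X as = map (\<lambda>k. (as ! k, X (as ! k, Suc (pulls (as ! k) (take k as))))) [0..<length as]"

lemma length_observed [simp]: "length (observed X as) = length as"
  by (simp add: observed_def)

lemma map_fst_observed [simp]: "map fst (observed X as) = as"
  by (simp add: observed_def o_def map_nth)

lemma observed_Nil [simp]: "observed X [] = []"
  by (simp add: observed_def)

lemma observed_snoc:
  "observed X (as @ [a]) = observed X as @ [(a, X (a, Suc (pulls a as)))]"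
  by (auto simp: observed_def nth_append)

primrec arms_pmf :: "(history \<Rightarrow> nat pmf) \<Rightarrow> (nat \<times> nat \<Rightarrow> real) \<Rightarrow> nat \<Rightarrow> nat list pmf" where
  "arms_pmf p X 0 = return_pmf []"
| "arms_pmf p X (Suc t) =
    bind_pmf (arms_pmf p X t) (\<lambda>as. map_pmf (\<lambda>a. as @ [a]) (p (observed X as)))"

lemma history_pmf_eq: "history_pmf p X t = map_pmf (observed X) (arms_pmf p X t)"
  by (induction t)
    (simp_all add: bind_map_pmf map_bind_pmf map_pmf_comp observed_snoc)

lemma map_fst_history_pmf: "map_pmf (map fst) (history_pmf p X t) = arms_pmf p X t"
  by (simp add: history_pmf_eq map_pmf_comp)

lemma arms_law_eq:
  "arms_law \<pi> T K \<nu> = reward_table K \<nu> \<bind> (\<lambda>X. measure_pmf (arms_pmf (\<pi> T K) X T))"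
  by (simp add: arms_law_def map_fst_history_pmf)

text \<open>Appending one arm is injective, so a single prefix contributes to the mixture. The
  resulting recursion expresses each probability as a finite product of decision probabilities,
  which is what the measurability proof needs.\<close>

lemma pmf_arms_pmf_snoc:
  "pmf (arms_pmf p X (Suc t)) (as @ [a]) =
    pmf (arms_pmf p X t) as * pmf (p (observed X as)) a"
proof -
  have "pmf (map_pmf (\<lambda>b. bs @ [b]) (p (observed X bs))) (as @ [a]) =
      indicator {as} bs * pmf (p (observed X as)) a" for bs
  proof (cases "bs = as")
    case True
    then show ?thesis
      using pmf_map_inj'[of "\<lambda>b. as @ [b]" "p (observed X as)" a] by (simp add: inj_def)
  next
    case False
    then show ?thesis
      by (auto simp: pmf_eq_0_set_pmf)
  qed
  then show ?thesis
    by (simp add: pmf_bind measure_pmf_single)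
qed

lemma pmf_arms_pmf_Nil: "pmf (arms_pmf p X (Suc t)) [] = 0"
  by (auto simp: pmf_eq_0_set_pmf)

section \<open>Support of the arm law and the reward cells that it reads\<close>

context
  fixes \<pi> :: algorithm and T K :: nat
  assumes alg: "bandit_algorithm \<pi>" and K: "K \<ge> 1"
begin

lemma set_arms_pmf:
  assumes "t \<le> T" "as \<in> set_pmf (arms_pmf (\<pi> T K) X t)"
  shows "length as = t \<and> set as \<subseteq> {1..K}"
  using assms
proof (induction t arbitrary: as)
  case (Suc t)
  then obtain bs a where bs: "bs \<in> set_pmf (arms_pmf (\<pi> T K) X t)"
    and a: "a \<in> set_pmf (\<pi> T K (observed X bs))" and as: "as = bs @ [a]"
    by auto
  from Suc bs have *: "length bs = t" "set bs \<subseteq> {1..K}" by auto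
  have "fst ` set (observed X bs) = set bs"
    by (metis map_fst_observed set_map)
  with * Suc.prems(1) alg K a have "a \<in> {1..K}"
    unfolding bandit_algorithm_def by (metis Suc_le_eq length_observed subsetD)
  with * as show ?case by auto
qed simp

text \<open>No arm is pulled more than T times within the horizon, so no cell beyond the first T
  rewards of an arm is read.\<close>

lemma arms_pmf_cong:
  assumes "t \<le> T" "\<And>i s. i \<in> {1..K} \<Longrightarrow> s \<in> {1..T} \<Longrightarrow> X (i, s) = Y (i, s)"
  shows "arms_pmf (\<pi> T K) X t = arms_pmf (\<pi> T K) Y t"
  using assms(1)
proof (induction t)
  case (Suc t)
  have "observed X as = observed Y as" if "as \<in> set_pmf (arms_pmf (\<pi> T K) Y t)" for as
  proof -
    from set_arms_pmf[OF _ that] Suc.prems have as: "length as = t" "set as \<subseteq> {1..K}" by auto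
    have "X (as ! k, Suc (pulls (as ! k) (take k as))) = Y (as ! k, Suc (pulls (as ! k) (take k as)))"
      if "k < t" for k
    proof (rule assms(2))
      show "as ! k \<in> {1..K}" using as that nth_mem by blast
      \<comment> \<open>Rounds are counted from 0 here: \<open>k\<close> earlier rounds contain at
        most \<open>k\<close> pulls, so the position read is at most \<open>k + 1\<close>, hence at
        most \<open>t\<close>.\<close>
      have "pulls (as ! k) (take k as) \<le> k"
        unfolding pulls_def by (metis count_le_length length_take min.bounded_iff)
      then show "Suc (pulls (as ! k) (take k as)) \<in> {1..T}" using that Suc.prems by auto
    qed
    then show ?thesis using as by (auto simp: observed_def)
  qed
  with Suc show ?case
    by (auto intro!: bind_pmf_cong)
qed simp

section \<open>Measurability in the reward table, for the finite and the infinite table at once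
  through the index set \<open>I\<close>\<close>

context
  fixes \<nu> :: "nat \<Rightarrow> real measure" and I :: "(nat \<times> nat) set"
  assumes sets: "\<And>i. i \<in> {1..K} \<Longrightarrow> sets (\<nu> i) = sets borel"
    and I: "{1..K} \<times> {1..T} \<subseteq> I" "fst ` I \<subseteq> {1..K}"
begin

text \<open>For a fixed arm list the cells read are fixed too, so the observed history is a tuple of
  constants and coordinate projections. Coded as a function on \<open>{..<length as}\<close>, it can
  be fed to the kernel clause of \<open>bandit_algorithm\<close>.\<close>

lemma measurable_pmf_rule:
  assumes "length as < T" "set as \<subseteq> {1..K}"
  shows "(\<lambda>X. pmf (\<pi> T K (observed X as)) a) \<in> borel_measurable (PiM I (\<lambda>(i, s). \<nu> i))"
proof -
  let ?t = "length as"
  let ?h = "\<lambda>X. \<lambda>k\<in>{..<?t}. (as ! k, X (as ! k, Suc (pulls (as ! k) (take k as))))"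
  have h: "?h \<in> PiM I (\<lambda>(i, s). \<nu> i) \<rightarrow>\<^sub>M (\<Pi>\<^sub>M s\<in>{..<?t}. count_space {1..K} \<Otimes>\<^sub>M borel)"
  proof (intro measurable_restrict measurable_Pair)
    fix k assume "k \<in> {..<?t}"
    then have k: "k < ?t" by simp
    then have a: "as ! k \<in> {1..K}" using assms nth_mem by blast
    then show "(\<lambda>X. as ! k) \<in> PiM I (\<lambda>(i, s). \<nu> i) \<rightarrow>\<^sub>M count_space {1..K}" by simp
    have "pulls (as ! k) (take k as) \<le> k"
      unfolding pulls_def by (metis count_le_length length_take min.bounded_iff)
    then have "(as ! k, Suc (pulls (as ! k) (take k as))) \<in> I"
      using k a assms I by auto
    from measurable_component_singleton[OF this, of "\<lambda>(i, s). \<nu> i"] a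
    show "(\<lambda>X. X (as ! k, Suc (pulls (as ! k) (take k as)))) \<in> PiM I (\<lambda>(i, s). \<nu> i) \<rightarrow>\<^sub>M borel"
      by (simp add: measurable_cong_sets[OF refl sets])
  qed
  have rule: "(\<lambda>h. measure_pmf (\<pi> T K (map h [0..<?t])))
      \<in> (\<Pi>\<^sub>M s\<in>{..<?t}. count_space {1..K} \<Otimes>\<^sub>M borel) \<rightarrow>\<^sub>M subprob_algebra (count_space UNIV)"
    using alg K assms unfolding bandit_algorithm_def by blast
  have "(\<lambda>X. emeasure (measure_pmf (\<pi> T K (map (?h X) [0..<?t]))) {a})
      \<in> borel_measurable (PiM I (\<lambda>(i, s). \<nu> i))"
    by (rule measurable_compose[OF h
          measurable_compose[OF rule measurable_emeasure_subprob_algebra[of "{a}"]]]) simp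
  then have "(\<lambda>X. measure (measure_pmf (\<pi> T K (map (?h X) [0..<?t]))) {a})
      \<in> borel_measurable (PiM I (\<lambda>(i, s). \<nu> i))"
    unfolding measure_def by measurable
  moreover have "map (?h X) [0..<?t] = observed X as" for X
    by (simp add: observed_def)
  ultimately show ?thesis by (simp add: pmf.rep_eq)
qed

lemma measurable_pmf_arms_pmf:
  assumes "t \<le> T"
  shows "(\<lambda>X. pmf (arms_pmf (\<pi> T K) X t) as) \<in> borel_measurable (PiM I (\<lambda>(i, s). \<nu> i))"
  using assms
proof (induction t arbitrary: as)
  case (Suc t)
  show ?case
  proof (cases as rule: rev_cases)
    case Nil
    then show ?thesis by (simp only: pmf_arms_pmf_Nil) simp
  next
    case (snoc bs a)
    show ?thesis
    proof (cases "length bs = t \<and> set bs \<subseteq> {1..K}")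
      case True
      then show ?thesis
        using Suc unfolding snoc pmf_arms_pmf_snoc
        by (intro borel_measurable_times measurable_pmf_rule) auto
    next
      case False
      \<comment> \<open>The kernel clause gives no information on such a prefix, but its probability
        vanishes for every table.\<close>
      then have "pmf (arms_pmf (\<pi> T K) X t) bs = 0" for X
        using set_arms_pmf[of t bs X] Suc.prems by (auto simp: pmf_eq_0_set_pmf)
      then show ?thesis unfolding snoc pmf_arms_pmf_snoc by simp
    qed
  qed
qed simp

text \<open>Arm lists are countable, so the probability of any set is an integral of point masses
  against counting measure, and pointwise measurability is enough.\<close>

lemma measurable_arms_pmf:
  "(\<lambda>X. measure_pmf (arms_pmf (\<pi> T K) X T))
    \<in> PiM I (\<lambda>(i, s). \<nu> i) \<rightarrow>\<^sub>M subprob_algebra (count_space UNIV)"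
proof (rule measurable_subprob_algebra)
  fix A :: "nat list set"
  have "(\<lambda>z. pmf (arms_pmf (\<pi> T K) (fst z) T) (snd z))
      \<in> borel_measurable (PiM I (\<lambda>(i, s). \<nu> i) \<Otimes>\<^sub>M count_space UNIV)"
    by (rule measurable_compose_countable[where g = snd])
      (rule measurable_compose[OF measurable_fst measurable_pmf_arms_pmf[OF order_refl]], rule measurable_snd)
  then have [measurable]: "(\<lambda>(X, as). pmf (arms_pmf (\<pi> T K) X T) as)
      \<in> borel_measurable (PiM I (\<lambda>(i, s). \<nu> i) \<Otimes>\<^sub>M count_space UNIV)"
    by (simp only: case_prod_beta')
  interpret sigma_finite_measure "count_space (UNIV :: nat list set)"
    by (rule sigma_finite_measure_count_space_countable) simp
  have "(\<lambda>X. \<integral>\<^sup>+as. ennreal (pmf (arms_pmf (\<pi> T K) X T) as) * indicator A as \<partial>count_space UNIV)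
      \<in> borel_measurable (PiM I (\<lambda>(i, s). \<nu> i))"
    by measurable
  then show "(\<lambda>X. emeasure (measure_pmf (arms_pmf (\<pi> T K) X T)) A)
      \<in> borel_measurable (PiM I (\<lambda>(i, s). \<nu> i))"
    by (simp add: nn_integral_measure_pmf[symmetric])
qed (auto simp: measure_pmf.subprob_space_axioms)

end

section \<open>The arm law as a probability measure and its reduction to a finite table\<close>

context
  fixes \<nu> :: "nat \<Rightarrow> real measure"
  assumes sets: "\<And>i. sets (\<nu> i) = sets borel" and prob: "\<And>i. prob_space (\<nu> i)"
begin

lemma prob_space_reward_table: "prob_space (reward_table K \<nu>)"
  unfolding reward_table_def by (rule prob_space_PiM) (auto intro: prob)

lemma measurable_arms_pmf_table:
  "(\<lambda>X. measure_pmf (arms_pmf (\<pi> T K) X T))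
    \<in> reward_table K \<nu> \<rightarrow>\<^sub>M subprob_algebra (count_space UNIV)"
  unfolding reward_table_def by (rule measurable_arms_pmf) (auto simp: sets)

lemma prob_space_arms_law: "prob_space (arms_law \<pi> T K \<nu>)"
  unfolding arms_law_eq
  by (rule prob_space.prob_space_bind[OF prob_space_reward_table _ measurable_arms_pmf_table])
    (simp add: measure_pmf.prob_space_axioms)

lemma sets_arms_law [measurable_cong]: "sets (arms_law \<pi> T K \<nu>) = sets (count_space UNIV)"
  unfolding arms_law_eq
  by (rule sets_bind[OF sets_kernel[OF measurable_arms_pmf_table]
        prob_space.not_empty[OF prob_space_reward_table]])

lemma AE_arms_law: "AE as in arms_law \<pi> T K \<nu>. length as = T \<and> set as \<subseteq> {1..K}"
  unfolding arms_law_eq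
  by (subst AE_bind[OF measurable_arms_pmf_table])
    (auto simp: AE_measure_pmf_iff simp del: One_nat_def intro!: AE_I2 dest!: set_arms_pmf[OF order_refl])

lemma integrable_pulls: "integrable (arms_law \<pi> T K \<nu>) (\<lambda>as. real (pulls i as))"
proof -
  interpret prob_space "arms_law \<pi> T K \<nu>" by (rule prob_space_arms_law)
  show ?thesis
  proof (rule integrable_const_bound[where B = "real T"])
    show "AE as in arms_law \<pi> T K \<nu>. norm (real (pulls i as)) \<le> real T"
      using AE_arms_law by eventually_elim (auto simp: pulls_def count_le_length)
  qed measurable
qed

text \<open>The integrand depends only on the cells in \<open>{1..K} \<times> {1..T}\<close>, and
  the marginal of an infinite product on finitely many coordinates is the finite product. The
  reduction matters for the change of measure: infinite Gaussian tables with different means are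
  mutually singular, so no likelihood ratio exists for them.\<close>

lemma measure_arms_law:
  "measure (arms_law \<pi> T K \<nu>) A =
    (\<integral>X. measure_pmf.prob (arms_pmf (\<pi> T K) X T) A \<partial>PiM ({1..K} \<times> {1..T}) (\<lambda>(i, s). \<nu> i))"
    (is "_ = (\<integral>X. ?g X \<partial>PiM ?J ?M)")
proof -
  interpret R: prob_space "reward_table K \<nu>" by (rule prob_space_reward_table)
  interpret product_prob_space ?M "{1..K} \<times> {1..}"
    using prob by (auto intro!: product_prob_spaceI split: prod.split)
  have g: "?g X = ?g (restrict X ?J)" for X
    by (rule arg_cong[where f = "\<lambda>p. measure_pmf.prob p A"], rule arms_pmf_cong) auto
  have meas: "(\<lambda>X. measure_pmf (arms_pmf (\<pi> T K) X T))
      \<in> PiM ?J ?M \<rightarrow>\<^sub>M subprob_algebra (count_space UNIV)"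
    by (rule measurable_arms_pmf) (auto simp: sets)
  have "?g \<in> borel_measurable (PiM ?J ?M)"
    unfolding measure_def
    by (intro borel_measurable_enn2real measurable_compose[OF meas measurable_emeasure_subprob_algebra]) simp
  then have "(\<integral>X. ?g X \<partial>PiM ?J ?M) =
      (\<integral>X. ?g (restrict X ?J) \<partial>PiM ({1..K} \<times> {1..}) ?M)"
    by (subst distr_PiM_restrict_finite[of ?J, symmetric])
      (auto intro!: integral_distr measurable_restrict_subset)
  also have "\<dots> = (\<integral>X. ?g X \<partial>reward_table K \<nu>)"
    unfolding reward_table_def g[symmetric] ..
  also have "\<dots> = measure (arms_law \<pi> T K \<nu>) A"
    unfolding arms_law_eq
    by (rule R.measure_bind[OF measurable_arms_pmf_table, symmetric]) simp
  finally show ?thesis ..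
qed

end

text \<open>Given the table, the probability of \<open>A\<close> is the same function under both
  instances; only the law of the table changes. The ratio covers all T rewards of every arm, pulled
  or not, so the bound does not depend on how the algorithm samples.\<close>

lemma measure_arms_law_gaussian_le:
  assumes "\<sigma> > 0" "\<eta> > 0"
  shows "measure (arms_law \<pi> T K (\<lambda>i. gaussian \<sigma> (m i))) A \<le>
    \<eta> / 2 * exp (real T * (\<Sum>i\<in>{1..K}. (m i)\<^sup>2) / \<sigma>\<^sup>2) +
    measure (arms_law \<pi> T K (\<lambda>i. gaussian \<sigma> 0)) A / (2 * \<eta>)"
proof -
  let ?J = "{1..K} \<times> {1..T}"
  let ?g = "\<lambda>X. measure_pmf.prob (arms_pmf (\<pi> T K) X T) A"
  let ?f = "\<lambda>(i, s :: nat). gaussian_ratio \<sigma> (m i)"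
  let ?b = "\<lambda>(i, s :: nat). exp ((m i)\<^sup>2 / \<sigma>\<^sup>2)"
  have tilt: "density (gaussian \<sigma> 0) (\<lambda>x. ennreal (?f j x)) = (case j of (i, s) \<Rightarrow> gaussian \<sigma> (m i))" for j
    using assms by (simp add: density_gaussian_ratio split: prod.split)
  have "(\<lambda>X. measure_pmf (arms_pmf (\<pi> T K) X T))
      \<in> PiM ?J (\<lambda>(i, s). gaussian \<sigma> 0) \<rightarrow>\<^sub>M subprob_algebra (count_space UNIV)"
    by (rule measurable_arms_pmf) auto
  then have g: "?g \<in> borel_measurable (PiM ?J (\<lambda>j. gaussian \<sigma> 0))"
    unfolding measure_def split_beta
    by (intro borel_measurable_enn2real measurable_compose[OF _ measurable_emeasure_subprob_algebra]) auto
  \<comment> \<open>Each arm owns T cells with the same second moment.\<close>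
  have "(\<Prod>j\<in>?J. ?b j) = (\<Prod>i\<in>{1..K}. exp (real T * ((m i)\<^sup>2 / \<sigma>\<^sup>2)))"
    by (simp add: prod.cartesian_product[symmetric] del: times_divide_eq_right flip: exp_of_nat_mult)
  also have "\<dots> = exp (real T * (\<Sum>i\<in>{1..K}. (m i)\<^sup>2) / \<sigma>\<^sup>2)"
    by (simp add: exp_sum[symmetric] sum_distrib_left sum_divide_distrib)
  finally have b: "(\<Prod>j\<in>?J. ?b j) = exp (real T * (\<Sum>i\<in>{1..K}. (m i)\<^sup>2) / \<sigma>\<^sup>2)" .
  have "(\<integral>X. ?g X \<partial>PiM ?J (\<lambda>j. density (gaussian \<sigma> 0) (\<lambda>x. ennreal (?f j x)))) \<le>
      \<eta> / 2 * (\<Prod>j\<in>?J. ?b j) + (\<integral>X. ?g X \<partial>PiM ?J (\<lambda>j. gaussian \<sigma> 0)) / (2 * \<eta>)"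
    by (rule integral_PiM_density_le)
      (use assms g in \<open>auto simp: prob_space_gaussian density_gaussian_ratio nn_integral_gaussian_ratio_sq
        split_beta measure_pmf.prob_le_1\<close>)
  then show ?thesis
    using assms unfolding b tilt
    by (subst (1 2) measure_arms_law) (auto simp: prob_space_gaussian case_prod_beta')
qed

end

section \<open>Instability\<close>

lemma gaussian_instance_in_sg_class:
  assumes "\<sigma> > 0" "2 \<le> K" "K \<le> Kbar" "\<And>i. \<bar>m i\<bar> \<le> M"
  shows "(K, \<lambda>i. gaussian \<sigma> (m i)) \<in> sg_class M \<sigma> Kbar"
  using assms(1-3) assms(4)[unfolded abs_le_iff]
  by (auto simp: sg_class_def prob_space_gaussian integrable_gaussian_ident mean_gaussian
      sub_gaussian_gaussian minus_le_iff)

text \<open>The mean T/2 prevents \<open>n T\<close> from being much smaller than T, since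
  \<open>N\<close> is bounded by T and close to \<open>n T\<close> off a rare event. A value of
  \<open>N\<close> below T/6 is then far from \<open>n T\<close> in ratio, which stability makes
  unlikely.\<close>

lemma stable_pulls_lower_bound:
  fixes Q :: "nat \<Rightarrow> 'a measure" and N :: "'a \<Rightarrow> real" and n :: "nat \<Rightarrow> real"
  assumes prob: "\<And>T. prob_space (Q T)" and sets: "\<And>T. sets (Q T) = UNIV"
    and N: "\<And>T. AE x in Q T. 0 \<le> N x \<and> N x \<le> real T"
    and half: "\<And>T. (\<integral>x. N x \<partial>Q T) = real T / 2"
    and n: "filterlim n at_top sequentially"
    and stable: "\<And>\<epsilon>. \<epsilon> > 0 \<Longrightarrow> (\<lambda>T. measure (Q T) {x. \<bar>N x / n T - 1\<bar> > \<epsilon>}) \<longlonglongrightarrow> 0"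
  shows "(\<lambda>T. measure (Q T) {x. N x < real T / 6}) \<longlonglongrightarrow> 0"
proof (rule tendsto_sandwich[OF _ _ tendsto_const stable])
  \<comment> \<open>The thresholds are matched: if \<open>n T < T/4\<close>, then \<open>N\<close>
    is at most (4/3)(T/4) = T/3 off the bad event and at most T on it, so its mean is below T/3 +
    T/6 = T/2.\<close>
  have "\<forall>\<^sub>F T in sequentially. measure (Q T) {x. \<bar>N x / n T - 1\<bar> > 1 / 3} < 1 / 6"
    by (intro order_tendstoD(2)[OF stable]) simp_all
  then show "\<forall>\<^sub>F T in sequentially. measure (Q T) {x. N x < real T / 6} \<le>
      measure (Q T) {x. \<bar>N x / n T - 1\<bar> > 1 / 3}"
    using eventually_gt_at_top[of 0]
      filterlim_at_top_dense[THEN iffD1, OF n, rule_format, of 0]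
  proof eventually_elim
    fix T
    let ?B = "{x. \<bar>N x / n T - 1\<bar> > 1 / 3}"
    assume B: "measure (Q T) ?B < 1 / 6" and T: "0 < T" and n: "0 < n T"
    interpret prob_space "Q T" by (rule prob)
    have [measurable]: "A \<in> sets (Q T)" for A by (simp add: sets)
    have [measurable]: "N \<in> borel_measurable (Q T)"
      by (simp add: measurable_def sets_eq_imp_space_eq sets space_borel)
    have "real T / 4 \<le> n T"
    proof (rule ccontr)
      assume "\<not> real T / 4 \<le> n T"
      then have small: "n T < real T / 4" by simp
      have "AE x in Q T. N x \<le> real T / 3 + real T * indicator ?B x"
        using N[of T]
      proof eventually_elim
        case (elim x)
        show ?case
        proof (cases "x \<in> ?B")
          case False
          then have "\<bar>N x / n T - 1\<bar> \<le> 1 / 3" by simp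
          then have "N x / n T \<le> 4 / 3" by linarith
          then have "N x \<le> 4 / 3 * n T" using n by (simp add: field_simps)
          then show ?thesis using small False by simp
        qed (use elim in auto)
      qed
      moreover have "integrable (Q T) N"
        using N[of T] by (intro integrable_const_bound[where B = "real T"]) auto
      ultimately have "(\<integral>x. N x \<partial>Q T) \<le> (\<integral>x. real T / 3 + real T * indicator ?B x \<partial>Q T)"
        by (intro integral_mono_AE) (auto simp: emeasure_eq_measure)
      also have "\<dots> = real T / 3 + real T * measure (Q T) ?B"
        by (subst Bochner_Integration.integral_add) (auto simp: emeasure_eq_measure prob_space)
      also have "\<dots> < real T / 3 + real T * (1 / 6)"
        using T B by (intro add_strict_left_mono mult_strict_left_mono) auto
      finally show False using half[of T] by simp
    qed
    \<comment> \<open>(T/6) / (T/4) = 2/3, which is exactly the tolerance 1/3 away from 1.\<close>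
    then have low: "N x / n T < 2 / 3" if "N x < real T / 6" for x
      using n that by (simp add: field_simps)
    have "{x. N x < real T / 6} \<subseteq> ?B"
    proof
      fix x assume "x \<in> {x. N x < real T / 6}"
      then have "N x / n T < 2 / 3" using low by simp
      then have "1 / 3 < \<bar>N x / n T - 1\<bar>" by linarith
      then show "x \<in> ?B" by simp
    qed
    then show "measure (Q T) {x. N x < real T / 6} \<le> measure (Q T) ?B"
      by (rule finite_measure_mono) simp
  qed
qed simp_all

theorem corollary6:
  fixes M \<sigma> :: real and Kbar :: nat and \<pi> :: algorithm
  assumes "M > 0" and "\<sigma> > 0" and "Kbar \<ge> 2"
    and "bandit_algorithm \<pi>"
    and "symmetric_on (sg_class M \<sigma> Kbar) \<pi>"
    and "explores_on (sg_class M \<sigma> Kbar) \<pi>"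
    and "minimax_optimal (sg_class M \<sigma> Kbar) \<pi>"
  shows "\<not> sampling_stable (sg_class M \<sigma> Kbar) \<pi>"
proof
  assume stable: "sampling_stable (sg_class M \<sigma> Kbar) \<pi>"
  define \<nu>\<^sub>0 :: "nat \<Rightarrow> real measure" where "\<nu>\<^sub>0 = (\<lambda>i. gaussian \<sigma> 0)"
  have \<nu>\<^sub>0: "(2, \<nu>\<^sub>0) \<in> sg_class M \<sigma> Kbar"
    unfolding \<nu>\<^sub>0_def using assms by (intro gaussian_instance_in_sg_class) auto
  note law = prob_space_arms_law[OF assms(4)] sets_arms_law[OF assms(4)] AE_arms_law[OF assms(4)]
    integrable_pulls[OF assms(4)]
  have pulls_sum: "real (pulls 1 as) + real (pulls 2 as) = real T"
    if "length as = T \<and> set as \<subseteq> {1..2}" for as T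
  proof -
    have "length as = (\<Sum>i\<in>{1..2}. count_list as i)"
      using that sum_count_set[of as "{1..2}"] by simp
    then show ?thesis using that by (simp add: pulls_def numeral_2_eq_2)
  qed
  have half: "expected_pulls \<pi> T 2 \<nu>\<^sub>0 1 = real T / 2" for T
  proof -
    interpret prob_space "arms_law \<pi> T 2 \<nu>\<^sub>0"
      unfolding \<nu>\<^sub>0_def using assms by (intro law) (auto simp: prob_space_gaussian)
    have "expected_pulls \<pi> T 2 \<nu>\<^sub>0 1 + expected_pulls \<pi> T 2 \<nu>\<^sub>0 2 =
        (\<integral>as. real (pulls 1 as) + real (pulls 2 as) \<partial>arms_law \<pi> T 2 \<nu>\<^sub>0)"
      unfolding expected_pulls_def \<nu>\<^sub>0_def using assms
      by (intro Bochner_Integration.integral_add[symmetric] law) (auto simp: prob_space_gaussian)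
    also have "\<dots> = (\<integral>as. real T \<partial>arms_law \<pi> T 2 \<nu>\<^sub>0)"
    proof (rule integral_cong_AE)
      have "AE as in arms_law \<pi> T 2 \<nu>\<^sub>0. length as = T \<and> set as \<subseteq> {1..2}"
        unfolding \<nu>\<^sub>0_def using assms by (intro law) (auto simp: prob_space_gaussian)
      then show "AE as in arms_law \<pi> T 2 \<nu>\<^sub>0. real (pulls 1 as) + real (pulls 2 as) = real T"
        by eventually_elim (rule pulls_sum)
    qed (use assms in \<open>auto simp: \<nu>\<^sub>0_def measurable_cong_sets[OF law(2) refl] prob_space_gaussian\<close>)
    also have "\<dots> = real T" by (simp add: prob_space)
    \<comment> \<open>Both arms carry the same law, so the symmetry assumption applies.\<close>
    also have "expected_pulls \<pi> T 2 \<nu>\<^sub>0 2 = expected_pulls \<pi> T 2 \<nu>\<^sub>0 1"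
    proof -
      have "\<forall>i\<in>{1..2}. \<forall>j\<in>{1..2}. i \<noteq> j \<and> \<nu>\<^sub>0 i = \<nu>\<^sub>0 j \<longrightarrow>
          expected_pulls \<pi> T 2 \<nu>\<^sub>0 i = expected_pulls \<pi> T 2 \<nu>\<^sub>0 j"
        using assms(5) \<nu>\<^sub>0 unfolding symmetric_on_def by blast
      from this[rule_format, of 2 1] show ?thesis by (simp add: \<nu>\<^sub>0_def)
    qed
    finally show ?thesis by simp
  qed
  have "\<exists>n :: nat \<Rightarrow> real. filterlim n at_top sequentially \<and>
      (\<forall>\<epsilon>>0. (\<lambda>T. measure (arms_law \<pi> T 2 \<nu>\<^sub>0) {as. \<bar>real (pulls 1 as) / n T - 1\<bar> > \<epsilon>})
        \<longlonglongrightarrow> 0)"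
    using stable \<nu>\<^sub>0 unfolding sampling_stable_def by force
  then obtain n :: "nat \<Rightarrow> real" where n: "filterlim n at_top sequentially"
    and conv: "\<And>\<epsilon>. \<epsilon> > 0 \<Longrightarrow>
      (\<lambda>T. measure (arms_law \<pi> T 2 \<nu>\<^sub>0) {as. \<bar>real (pulls 1 as) / n T - 1\<bar> > \<epsilon>}) \<longlonglongrightarrow> 0"
    by blast
  define A where "A T = {as. real (pulls 1 as) < real T / 6}" for T
  have lim: "(\<lambda>T. measure (arms_law \<pi> T 2 \<nu>\<^sub>0) (A T)) \<longlonglongrightarrow> 0"
    unfolding A_def
  proof (rule stable_pulls_lower_bound[OF _ _ _ _ n conv])
    fix T
    show "prob_space (arms_law \<pi> T 2 \<nu>\<^sub>0)" "sets (arms_law \<pi> T 2 \<nu>\<^sub>0) = UNIV"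
      unfolding \<nu>\<^sub>0_def using assms by (auto simp: law prob_space_gaussian)
    have "AE as in arms_law \<pi> T 2 \<nu>\<^sub>0. length as = T \<and> set as \<subseteq> {1..2}"
      unfolding \<nu>\<^sub>0_def using assms by (intro law) (auto simp: prob_space_gaussian)
    then show "AE as in arms_law \<pi> T 2 \<nu>\<^sub>0. 0 \<le> real (pulls 1 as) \<and> real (pulls 1 as) \<le> real T"
      by eventually_elim (auto simp: pulls_def count_le_length)
    show "(\<integral>as. real (pulls 1 as) \<partial>arms_law \<pi> T 2 \<nu>\<^sub>0) = real T / 2"
      using half[of T] by (simp add: expected_pulls_def)
  qed
  from assms(7) obtain c where c: "c > 0"
    and minimax: "\<And>T. minimax_regret (sg_class M \<sigma> Kbar) \<pi> T \<le> ereal (c * sqrt (real T))"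
    unfolding minimax_optimal_def by blast
  \<comment> \<open>The final regret bound is \<open>C / 12 * sqrt T\<close>; any factor above 12
    gives the contradiction.\<close>
  define C where "C = 13 * c"
  \<comment> \<open>With this \<eta> the second-moment term equals 1/4. A null probability below
    \<open>\<eta> / 2\<close> makes the other term at most 1/4 as well.\<close>
  define \<eta> where "\<eta> = exp (- (C\<^sup>2 / \<sigma>\<^sup>2)) / 2"
  have "\<eta> > 0" by (simp add: \<eta>_def)
  have "(\<lambda>T. C / sqrt (real T)) \<longlonglongrightarrow> 0"
    by real_asymp
  then have "\<forall>\<^sub>F T in sequentially. C / sqrt (real T) < M"
    using \<open>M > 0\<close> by (rule order_tendstoD)
  moreover have "\<forall>\<^sub>F T in sequentially. measure (arms_law \<pi> T 2 \<nu>\<^sub>0) (A T) < \<eta> / 2"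
    using \<open>\<eta> > 0\<close> by (intro order_tendstoD(2)[OF lim]) simp
  \<comment> \<open>T is chosen after \<open>C\<close> and \<eta>: large enough for the shifted mean
    to stay in the class and for \<open>A T\<close> to be rare under equal arms.\<close>
  ultimately have "\<forall>\<^sub>F T in sequentially. C / sqrt (real T) < M \<and>
      measure (arms_law \<pi> T 2 \<nu>\<^sub>0) (A T) < \<eta> / 2 \<and> T > 0"
    using eventually_gt_at_top[of 0] by eventually_elim simp
  then obtain T where T: "C / sqrt (real T) < M"
    "measure (arms_law \<pi> T 2 \<nu>\<^sub>0) (A T) < \<eta> / 2" "T > 0"
    using eventually_happens' sequentially_bot by blast
  define d where "d = C / sqrt (real T)"
  define m :: "nat \<Rightarrow> real" where "m i = (if i = 2 then d else 0)" for i
  define \<nu> where "\<nu> i = gaussian \<sigma> (m i)" for i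
  have d: "d > 0" using c T by (simp add: d_def C_def)
  have \<nu>: "(2, \<nu>) \<in> sg_class M \<sigma> Kbar"
    unfolding \<nu>_def using assms T d
    by (intro gaussian_instance_in_sg_class) (auto simp: m_def d_def)
  interpret P: prob_space "arms_law \<pi> T 2 \<nu>"
    unfolding \<nu>_def using assms by (intro law) (auto simp: prob_space_gaussian)
  have sets_P: "sets (arms_law \<pi> T 2 \<nu>) = UNIV"
    unfolding \<nu>_def using assms by (subst law) (auto simp: prob_space_gaussian)
  then have space_P: "space (arms_law \<pi> T 2 \<nu>) = UNIV"
    using sets_eq_imp_space_eq[of "arms_law \<pi> T 2 \<nu>" "count_space UNIV"] by simp
  have int: "integrable (arms_law \<pi> T 2 \<nu>) (\<lambda>as. real (pulls i as))" for i
    unfolding \<nu>_def using assms by (intro law) (auto simp: prob_space_gaussian)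
  have "(\<Sum>i\<in>{1..2}. (m i)\<^sup>2) = d\<^sup>2"
    by (simp add: m_def numeral_2_eq_2)
  \<comment> \<open>The scaling \<open>d = C / sqrt T\<close> cancels T, which is why \<eta> could
    be fixed beforehand.\<close>
  then have "real T * (\<Sum>i\<in>{1..2}. (m i)\<^sup>2) / \<sigma>\<^sup>2 = C\<^sup>2 / \<sigma>\<^sup>2"
    using T unfolding \<open>(\<Sum>i\<in>{1..2}. (m i)\<^sup>2) = d\<^sup>2\<close> by (simp add: d_def power_divide)
  moreover have "\<eta> / 2 * exp (C\<^sup>2 / \<sigma>\<^sup>2) = 1 / 4"
    by (simp add: \<eta>_def exp_minus)
  ultimately have "measure (arms_law \<pi> T 2 \<nu>) (A T) \<le>
      1 / 4 + measure (arms_law \<pi> T 2 \<nu>\<^sub>0) (A T) / (2 * \<eta>)"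
    using measure_arms_law_gaussian_le[OF assms(4) _ \<open>\<sigma> > 0\<close> \<open>\<eta> > 0\<close>, of 2 T m "A T"]
    by (simp only: \<nu>_def[abs_def] \<nu>\<^sub>0_def)
  also have "\<dots> \<le> 1 / 4 + 1 / 4"
    using T(2) \<open>\<eta> > 0\<close> by (simp add: field_simps)
  finally have "1 / 2 \<le> 1 - P.prob (A T)" by simp
  also have "\<dots> = P.prob (- A T)"
    using P.prob_compl[of "A T"] by (simp add: Compl_eq_Diff_UNIV sets_P space_P)
  also have "\<dots> \<le> P.prob {as \<in> space (arms_law \<pi> T 2 \<nu>). real T / 6 \<le> real (pulls 1 as)}"
    by (intro P.finite_measure_mono) (auto simp: A_def sets_P space_P)
  \<comment> \<open>Markov's inequality: at least T/6 pulls with probability at least 1/2 give a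
    mean of at least T/12.\<close>
  also have "\<dots> \<le> expected_pulls \<pi> T 2 \<nu> 1 / (real T / 6)"
    unfolding expected_pulls_def using T int by (intro integral_Markov_inequality_measure[where A = "{}"]) auto
  finally have pulls: "real T / 12 \<le> expected_pulls \<pi> T 2 \<nu> 1"
    using T by (simp add: field_simps)
  have "{1..2 :: nat} = {1, 2}" by auto
  \<comment> \<open>Arm 2 is now the optimal one, so only arm 1 contributes, with gap
    \<open>d\<close>.\<close>
  then have "regret \<pi> T 2 \<nu> = d * expected_pulls \<pi> T 2 \<nu> 1"
    using assms d by (simp add: regret_def gap_def \<nu>_def mean_gaussian m_def)
  also have "\<dots> \<ge> d * (real T / 12)"
    using pulls d by (intro mult_left_mono) auto
  also have "d * (real T / 12) = C / 12 * (real T / sqrt (real T))"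
    by (simp add: d_def)
  finally have "C / 12 * sqrt (real T) \<le> regret \<pi> T 2 \<nu>"
    by (simp add: real_div_sqrt)
  moreover have "ereal (regret \<pi> T 2 \<nu>) \<le> ereal (c * sqrt (real T))"
    by (rule order_trans[OF _ minimax[of T]], unfold minimax_regret_def, rule SUP_upper2[OF \<nu>]) simp
  moreover have "c * sqrt (real T) < C / 12 * sqrt (real T)"
    using c T by (simp add: C_def)
  ultimately show False by simp
qed

end
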